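(* Let $X,Y$ be Banach spaces, $T\in\mathcal{L}(X,Y)$ and $1\leq p<\infty$. Then $uc(T)\leq uc_{p}^{6}(T)\leq cc(T)$.
   Context: Banach spaces are real or complex; $\mathcal{L}(X,Y)$ is the space of continuous linear maps from $X$ to $Y$; $B_Z$ is the closed unit ball of $Z$. For $1\le p<\infty$, a sequence $(x_n)_n$ in $X$ is weakly $p$-summable, written $(x_n)_n\in l_p^w(X)$, if $\|(x_n)_n\|_p^w:=\sup\{(\sum_{n=1}^{\infty}|\langle x^*,x_n\rangle|^p)^{1/p}:x^*\in B_{X^*}\}<\infty$. For a bounded sequence, $ca((x_n)_n)=\inf_n\sup\{\|x_k-x_l\|:k,l\geq n\}$. Define $uc(T)=\sup\{ca((\sum_{i=1}^{n}Tx_i)_n):(x_n)_n\in l_1^w(X),\ \|(x_n)_n\|_1^w\leq 1\}$; $uc_p^6(T)=\sup\{\limsup_n\|Tx_n\|:(x_n)_n\in l_p^w(X),\ \|(x_n)_n\|_p^w\leq 1\}$; $cc(T)=\sup\{ca((Tx_n)_n):(x_n)_n\subset B_X\text{ weakly Cauchy}\}$. *)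

theory Defs
  imports "HOL-Analysis.Analysis"
begin

text \<open>
  The library has no class of complex normed spaces.  A complex Banach space is a type of class
  \<^class>\<open>banach\<close> with a complex scalar multiplication that extends the real one and for which the
  norm is homogeneous.  The notions below take the scalar multiplication \<open>s\<close> as a parameter: it is
  \<^const>\<open>scaleR\<close> for a real Banach space.
\<close>

locale complex_banach_space = vector_space s
  for s :: "complex \<Rightarrow> 'a::banach \<Rightarrow> 'a" +
  assumes scale_of_real: "s (of_real r) x = r *\<^sub>R x"
    and norm_scale: "norm (s c x) = norm c * norm x"

definition dual :: "('k::real_normed_field \<Rightarrow> 'a::real_normed_vector \<Rightarrow> 'a) \<Rightarrow> ('a \<Rightarrow> 'k) set"
  where "dual s = {f. bounded_linear f \<and> (\<forall>c x. f (s c x) = c * f x)}"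

definition dual_ball :: "('k::real_normed_field \<Rightarrow> 'a::real_normed_vector \<Rightarrow> 'a) \<Rightarrow> ('a \<Rightarrow> 'k) set"
  where "dual_ball s = {f \<in> dual s. onorm f \<le> 1}"

lemma dual_scaleR: "dual scaleR = {f :: 'a::real_normed_vector \<Rightarrow> real. bounded_linear f}"
  by (auto simp: dual_def bounded_linear.linear linear_scale)

text \<open>The \<open>l\<^sub>p\<close> norm, with value \<open>\<infinity>\<close> on the sequences that are not \<open>p\<close>-summable.\<close>

definition lp_norm :: "real \<Rightarrow> (nat \<Rightarrow> 'k::real_normed_vector) \<Rightarrow> ereal"
  where "lp_norm p a =
    (if summable (\<lambda>n. norm (a n) powr p)
     then ereal ((\<Sum>n. norm (a n) powr p) powr (1 / p)) else \<infinity>)"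

definition weak_lp_norm ::
    "('k::real_normed_field \<Rightarrow> 'a::real_normed_vector \<Rightarrow> 'a) \<Rightarrow> real \<Rightarrow> (nat \<Rightarrow> 'a) \<Rightarrow> ereal"
  where "weak_lp_norm s p x = (SUP f\<in>dual_ball s. lp_norm p (\<lambda>n. f (x n)))"

definition weakly_p_summable ::
    "('k::real_normed_field \<Rightarrow> 'a::real_normed_vector \<Rightarrow> 'a) \<Rightarrow> real \<Rightarrow> (nat \<Rightarrow> 'a) \<Rightarrow> bool"
  where "weakly_p_summable s p x \<longleftrightarrow> weak_lp_norm s p x < \<infinity>"

definition weakly_Cauchy ::
    "('k::real_normed_field \<Rightarrow> 'a::real_normed_vector \<Rightarrow> 'a) \<Rightarrow> (nat \<Rightarrow> 'a) \<Rightarrow> bool"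
  where "weakly_Cauchy s x \<longleftrightarrow> (\<forall>f\<in>dual s. Cauchy (\<lambda>n. f (x n)))"

definition ca :: "(nat \<Rightarrow> 'b::real_normed_vector) \<Rightarrow> ereal"
  where "ca y = (INF n. Sup {ereal (norm (y k - y l)) | k l. n \<le> k \<and> n \<le> l})"

text \<open>Sequences are indexed from \<open>0\<close>.\<close>

definition uc ::
    "('k::real_normed_field \<Rightarrow> 'a::real_normed_vector \<Rightarrow> 'a) \<Rightarrow> ('a \<Rightarrow> 'b::real_normed_vector) \<Rightarrow> ereal"
  where "uc s T =
    Sup {ca (\<lambda>n. \<Sum>i\<le>n. T (x i)) | x. weakly_p_summable s 1 x \<and> weak_lp_norm s 1 x \<le> 1}"

definition uc6 ::
    "('k::real_normed_field \<Rightarrow> 'a::real_normed_vector \<Rightarrow> 'a) \<Rightarrow> real \<Rightarrow>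
      ('a \<Rightarrow> 'b::real_normed_vector) \<Rightarrow> ereal"
  where "uc6 s p T =
    Sup {limsup (\<lambda>n. ereal (norm (T (x n)))) | x. weakly_p_summable s p x \<and> weak_lp_norm s p x \<le> 1}"

definition cc ::
    "('k::real_normed_field \<Rightarrow> 'a::real_normed_vector \<Rightarrow> 'a) \<Rightarrow> ('a \<Rightarrow> 'b::real_normed_vector) \<Rightarrow> ereal"
  where "cc s T =
    Sup {ca (\<lambda>n. T (x n)) | x. range x \<subseteq> cball 0 1 \<and> weakly_Cauchy s x}"

end

theory Submission
  imports Defs
begin

text \<open>
  The first inequality holds because blocks of a series inherit weak summability.  If the partial
  sums of \<open>\<Sum>i. T (x i)\<close> oscillate by more than \<open>c\<close> arbitrarily far out, then there are
  consecutive blocks of indices, pairwise disjoint, on which the vectors \<open>T (x i)\<close> add up to a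
  vector of norm more than \<open>c\<close>.  Let \<open>y j\<close> be the sum of the \<open>x i\<close> over the \<open>j\<close>-th block.  For a
  functional \<open>f\<close> of norm at most \<open>1\<close>, disjointness gives
  \<open>\<Sum>j. \<bar>f (y j)\<bar> \<le> \<Sum>i. \<bar>f (x i)\<bar> \<le> 1\<close>; every term is then at most \<open>1\<close>, so raising the terms to the
  power \<open>p \<ge> 1\<close> only decreases them.  Thus \<open>y\<close> competes in the definition of the second quantity,
  and \<open>T\<close> keeps its norm above \<open>c\<close>.  This is \<open>weak_lp_norm_blocks_le_one\<close> and \<open>uc_le_uc6\<close>.

  For the second inequality (\<open>uc6_le_cc\<close>), let \<open>x\<close> have weak \<open>p\<close>-norm at most \<open>1\<close>.  It is weakly
  null, but \<open>ca\<close> of \<open>T (x n)\<close> can be smaller than the upper limit of \<open>norm (T (x n))\<close>.  The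
  interleaved sequence \<open>x 0, 0, x 1, 0, \<dots>\<close> is still weakly null, and comparing its neighbouring
  terms shows that \<open>ca\<close> of its image is at least that upper limit.  The interleaved sequence has
  to lie in the unit ball; each functional \<open>f\<close> in the dual ball satisfies \<open>\<bar>f (x n)\<bar> \<le> 1\<close>, and the
  Hahn-Banach theorem turns this into \<open>norm (x n) \<le> 1\<close>.

  The Hahn-Banach theorem is obtained from Zorn's lemma applied to sublinear functionals instead of
  partial linear ones: below every sublinear functional there is a minimal one, and minimal
  sublinear functionals are linear.  Complex functionals are built from real ones by
  \<open>F v = f v - \<i> f (\<i> v)\<close>.  Both inequalities are proved over an arbitrary scalar field, the second
  one for scalar multiplications that admit norming functionals.
\<close>

section \<open>The Hahn-Banach theorem for norms\<close>

definition sublinear :: "('a::real_vector \<Rightarrow> real) \<Rightarrow> bool"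
  where "sublinear q \<longleftrightarrow>
    (\<forall>x y. q (x + y) \<le> q x + q y) \<and> (\<forall>c x. 0 < c \<longrightarrow> q (c *\<^sub>R x) = c * q x)"

lemma sublinear_add: "sublinear q \<Longrightarrow> q (x + y) \<le> q x + q y"
  and sublinear_scale: "sublinear q \<Longrightarrow> 0 < c \<Longrightarrow> q (c *\<^sub>R x) = c * q x"
  by (auto simp: sublinear_def)

lemma sublinear_zero: "sublinear q \<Longrightarrow> q 0 = 0"
  using sublinear_scale[of q 2 0] by simp

lemma sublinear_scale_nonneg: "sublinear q \<Longrightarrow> 0 \<le> c \<Longrightarrow> q (c *\<^sub>R x) = c * q x"
  by (cases "c = 0") (auto simp: sublinear_scale sublinear_zero)

lemma sublinear_minus_le: "sublinear q \<Longrightarrow> - q (- x) \<le> q x"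
  using sublinear_add[of q x "- x"] sublinear_zero[of q] by simp

lemma sublinear_norm: "sublinear (norm :: 'a::real_normed_vector \<Rightarrow> real)"
  by (auto simp: sublinear_def norm_triangle_ineq)

text \<open>The inequality in the scaling law suffices, because it can be used for \<open>inverse c\<close> too.\<close>

lemma sublinearI:
  assumes "\<And>x y. q (x + y) \<le> q x + q y"
    and "\<And>c x. 0 < c \<Longrightarrow> q (c *\<^sub>R x) \<le> c * q x"
  shows "sublinear q"
  unfolding sublinear_def
proof (intro conjI allI impI)
  fix c :: real and x
  assume c: "0 < c"
  have "q (inverse c *\<^sub>R (c *\<^sub>R x)) \<le> inverse c * q (c *\<^sub>R x)"
    using c by (intro assms(2)) simp
  then have "c * q x \<le> q (c *\<^sub>R x)"
    using c by (simp add: field_simps)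
  with assms(2)[OF c, of x] show "q (c *\<^sub>R x) = c * q x"
    by simp
qed (rule assms(1))

text \<open>
  This is the largest sublinear functional \<open>r \<le> q\<close> with \<open>r (- y) \<le> - q y\<close>, i.e. the best way of
  lowering \<open>q\<close> so that it becomes additive on the line through \<open>y\<close>.
\<close>

definition tilt :: "'a \<Rightarrow> ('a::real_vector \<Rightarrow> real) \<Rightarrow> 'a \<Rightarrow> real"
  where "tilt y q x = (INF t\<in>{0..}. q (x + t *\<^sub>R y) - t * q y)"

text \<open>
  The infimum is finite since \<open>- q (- x)\<close> bounds all its terms from below.  It is subadditive
  because the terms for \<open>u\<close> at \<open>s\<close> and for \<open>v\<close> at \<open>t\<close> together dominate the term for \<open>u + v\<close> at
  \<open>s + t\<close>, and homogeneous because the ray \<open>{0..}\<close> is invariant under scaling.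
\<close>

lemma
  assumes q: "sublinear q"
  shows tilt_le_at: "0 \<le> t \<Longrightarrow> tilt y q x \<le> q (x + t *\<^sub>R y) - t * q y"
    and sublinear_tilt: "sublinear (tilt y q)"
proof -
  have low: "- q (- x) \<le> q (x + t *\<^sub>R y) - t * q y" if "0 \<le> t" for t x
    using sublinear_add[OF q, of "x + t *\<^sub>R y" "- x"] sublinear_scale_nonneg[OF q that, of y]
    by simp
  have bdd: "bdd_below ((\<lambda>t. q (x + t *\<^sub>R y) - t * q y) ` {0..})" for x
    by (rule bdd_belowI2[of _ "- q (- x)"]) (use low in auto)
  show le: "tilt y q x \<le> q (x + t *\<^sub>R y) - t * q y" if "0 \<le> t" for t x
    unfolding tilt_def by (rule cINF_lower[OF bdd]) (use that in auto)
  have ge: "m \<le> tilt y q x" if "\<And>t. 0 \<le> t \<Longrightarrow> m \<le> q (x + t *\<^sub>R y) - t * q y" for m x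
    unfolding tilt_def by (rule cINF_greatest) (use that in auto)
  show "sublinear (tilt y q)"
  proof (rule sublinearI)
    fix u v
    have *: "tilt y q (u + v) \<le> (q (u + s *\<^sub>R y) - s * q y) + (q (v + t *\<^sub>R y) - t * q y)"
      if "0 \<le> s" "0 \<le> t" for s t
      using le[of "s + t" "u + v"] that sublinear_add[OF q, of "u + s *\<^sub>R y" "v + t *\<^sub>R y"]
      by (simp add: algebra_simps)
    have "tilt y q (u + v) - tilt y q v \<le> tilt y q u"
    proof (rule ge)
      fix s :: real
      assume s: "0 \<le> s"
      have "tilt y q (u + v) - (q (u + s *\<^sub>R y) - s * q y) \<le> tilt y q v"
      proof (rule ge)
        fix t :: real
        assume "0 \<le> t"
        then show "tilt y q (u + v) - (q (u + s *\<^sub>R y) - s * q y) \<le> q (v + t *\<^sub>R y) - t * q y"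
          using *[OF s, of t] by linarith
      qed
      then show "tilt y q (u + v) - tilt y q v \<le> q (u + s *\<^sub>R y) - s * q y"
        by simp
    qed
    then show "tilt y q (u + v) \<le> tilt y q u + tilt y q v"
      by simp
  next
    fix c :: real and x
    assume c: "0 < c"
    have "tilt y q (c *\<^sub>R x) / c \<le> tilt y q x"
    proof (rule ge)
      fix t :: real
      assume t: "0 \<le> t"
      have "tilt y q (c *\<^sub>R x) \<le> q (c *\<^sub>R (x + t *\<^sub>R y)) - c * t * q y"
        using le[of "c * t" "c *\<^sub>R x"] c t by (simp add: algebra_simps)
      also have "\<dots> = c * (q (x + t *\<^sub>R y) - t * q y)"
        by (simp only: sublinear_scale[OF q c]) (simp add: algebra_simps)
      finally show "tilt y q (c *\<^sub>R x) / c \<le> q (x + t *\<^sub>R y) - t * q y"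
        using c by (simp add: field_simps)
    qed
    then show "tilt y q (c *\<^sub>R x) \<le> c * tilt y q x"
      using c by (simp add: field_simps)
  qed
qed

lemma tilt_le: "sublinear q \<Longrightarrow> tilt y q x \<le> q x"
  using tilt_le_at[of q 0 y x] by simp

text \<open>
  Tilting a minimal \<open>q\<close> along \<open>y\<close> cannot lower it, and the term of the infimum at \<open>t = 1\<close> then reads
  \<open>q x \<le> q (x + y) - q y\<close>, the missing half of additivity.
\<close>

lemma linear_minimal_sublinear:
  assumes q: "sublinear q"
    and minimal: "\<And>r. sublinear r \<Longrightarrow> r \<le> q \<Longrightarrow> r = q"
  shows "linear q"
proof (rule linearI)
  show add: "q (x + y) = q x + q y" for x y
  proof -
    have "tilt y q = q"
      using q by (intro minimal sublinear_tilt) (auto simp: le_fun_def tilt_le)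
    then have "q x \<le> q (x + y) - q y"
      using tilt_le_at[OF q, of 1 y x] by simp
    with sublinear_add[OF q, of x y] show ?thesis by simp
  qed
  have minus: "q (- x) = - q x" for x
    using add[of x "- x"] sublinear_zero[OF q] by simp
  show "q (c *\<^sub>R x) = c *\<^sub>R q x" for c x
  proof (cases "0 \<le> c")
    case True
    then show ?thesis by (simp add: sublinear_scale_nonneg[OF q])
  next
    case False
    then have "q ((- c) *\<^sub>R x) = (- c) * q x"
      by (intro sublinear_scale_nonneg[OF q]) simp
    then show ?thesis using minus[of "c *\<^sub>R x"] by simp
  qed
qed

text \<open>
  Subadditivity survives the infimum because, of two members of a chain, the smaller one bounds
  both terms.  The common upper bound \<open>q\<close> keeps the infimum finite: all members lie above
  \<open>- q (- x)\<close> at \<open>x\<close>.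
\<close>

lemma sublinear_INF_chain:
  fixes C :: "('a::real_vector \<Rightarrow> real) set"
  assumes ne: "C \<noteq> {}" and sub: "\<And>r. r \<in> C \<Longrightarrow> sublinear r" and below: "\<And>r. r \<in> C \<Longrightarrow> r \<le> q"
    and chain: "\<And>r r'. r \<in> C \<Longrightarrow> r' \<in> C \<Longrightarrow> r \<le> r' \<or> r' \<le> r"
  shows "sublinear (\<lambda>x. INF r\<in>C. r x)" and "r \<in> C \<Longrightarrow> (INF r\<in>C. r x) \<le> r x"
proof -
  have low: "- q (- x) \<le> r x" if "r \<in> C" for r x
    using sublinear_minus_le[OF sub[OF that], of x] below[OF that, THEN le_funD, of "- x"] by simp
  have bdd: "bdd_below ((\<lambda>r. r x) ` C)" for x
    by (rule bdd_belowI2[of _ "- q (- x)"]) (use low in auto)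
  show le: "(INF r\<in>C. r x) \<le> r x" if "r \<in> C" for r x
    by (rule cINF_lower[OF bdd that])
  have ge: "m \<le> (INF r\<in>C. r x)" if "\<And>r. r \<in> C \<Longrightarrow> m \<le> r x" for m x
    by (rule cINF_greatest[OF ne that])
  show "sublinear (\<lambda>x. INF r\<in>C. r x)"
  proof (rule sublinearI)
    fix x y
    have *: "(INF r\<in>C. r (x + y)) \<le> r x + r' y" if r: "r \<in> C" "r' \<in> C" for r r'
    proof -
      obtain w where w: "w \<in> C" "w \<le> r" "w \<le> r'"
        using chain[OF r] r by auto
      have "(INF r\<in>C. r (x + y)) \<le> w (x + y)" by (rule le[OF w(1)])
      also have "\<dots> \<le> w x + w y" by (rule sublinear_add[OF sub[OF w(1)]])
      also have "\<dots> \<le> r x + r' y" using w by (intro add_mono) (auto simp: le_fun_def)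
      finally show ?thesis .
    qed
    have "(INF r\<in>C. r (x + y)) - (INF r\<in>C. r y) \<le> (INF r\<in>C. r x)"
    proof (rule ge)
      fix r assume r: "r \<in> C"
      have "(INF r\<in>C. r (x + y)) - r x \<le> (INF r\<in>C. r y)"
        by (rule ge) (use *[OF r] in \<open>simp add: algebra_simps\<close>)
      then show "(INF r\<in>C. r (x + y)) - (INF r\<in>C. r y) \<le> r x" by simp
    qed
    then show "(INF r\<in>C. r (x + y)) \<le> (INF r\<in>C. r x) + (INF r\<in>C. r y)" by simp
  next
    fix c :: real and x
    assume c: "0 < c"
    have "(INF r\<in>C. r (c *\<^sub>R x)) / c \<le> (INF r\<in>C. r x)"
    proof (rule ge)
      fix r assume r: "r \<in> C"
      have "(INF r\<in>C. r (c *\<^sub>R x)) \<le> c * r x"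
        using le[OF r, of "c *\<^sub>R x"] sublinear_scale[OF sub[OF r] c] by simp
      then show "(INF r\<in>C. r (c *\<^sub>R x)) / c \<le> r x"
        using c by (simp add: field_simps)
    qed
    then show "(INF r\<in>C. r (c *\<^sub>R x)) \<le> c * (INF r\<in>C. r x)"
      using c by (simp add: field_simps)
  qed
qed

text \<open>
  In the reversed pointwise order, pointwise infima bound chains of sublinear functionals below
  \<open>q\<close>.  Zorn's lemma thus yields a minimal functional below \<open>q\<close>, and minimality makes it linear.
\<close>

lemma Hahn_Banach_sublinear:
  fixes q :: "'a::real_vector \<Rightarrow> real"
  assumes q: "sublinear q"
  obtains f where "linear f" "f \<le> q"
proof -
  define A where "A = {r. sublinear r \<and> r \<le> q}"
  let ?R = "relation_of (\<lambda>r r'. r' \<le> r) A"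
  have "\<exists>m\<in>A. \<forall>r\<in>A. r \<le> m \<longrightarrow> r = m"
  proof (rule predicate_Zorn)
    show "partial_order_on A ?R"
      by (rule partial_order_on_relation_ofI) auto
    fix C assume C: "C \<in> Chains ?R"
    show "\<exists>u\<in>A. \<forall>r\<in>C. u \<le> r"
    proof (cases "C = {}")
      case True
      then show ?thesis using q by (auto simp: A_def)
    next
      case False
      have CA: "r \<in> A" if "r \<in> C" for r
        using C that by (auto simp: Chains_def relation_of_def)
      have sub: "sublinear r" and below: "r \<le> q" if "r \<in> C" for r
        using CA[OF that] by (auto simp: A_def)
      have chain: "r \<le> r' \<or> r' \<le> r" if "r \<in> C" "r' \<in> C" for r r'
        using C that by (auto simp: Chains_def relation_of_def)
      define u where "u = (\<lambda>x. INF r\<in>C. r x)"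
      have u: "sublinear u" "\<forall>r\<in>C. u \<le> r"
        using sublinear_INF_chain[OF False sub below chain] by (auto simp: u_def le_fun_def)
      obtain r where "r \<in> C" using False by auto
      with u below have "u \<le> q" by (meson order_trans)
      with u show ?thesis by (auto simp: A_def)
    qed
  qed
  then obtain m where m: "m \<in> A" and min: "\<And>r. r \<in> A \<Longrightarrow> r \<le> m \<Longrightarrow> r = m"
    by auto
  have "linear m"
  proof (rule linear_minimal_sublinear)
    show "sublinear m" using m by (simp add: A_def)
    fix r assume "sublinear r" "r \<le> m"
    with m show "r = m" by (intro min) (auto simp: A_def)
  qed
  with m show ?thesis by (intro that) (auto simp: A_def)
qed

text \<open>
  A linear functional below the norm is bounded by it in absolute value.  To force the value
  \<open>norm x\<close> at \<open>x\<close>, the norm is first tilted along \<open>x\<close>: a linear \<open>f\<close> below the result satisfies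
  \<open>f (- x) \<le> - norm x\<close>.
\<close>

lemma norming_real_functional:
  fixes x :: "'a::real_normed_vector"
  obtains f :: "'a \<Rightarrow> real" where "linear f" "\<And>v. \<bar>f v\<bar> \<le> norm v" "f x = norm x"
proof -
  let ?q = "tilt x (norm :: 'a \<Rightarrow> real)"
  obtain f :: "'a \<Rightarrow> real" where f: "linear f" "f \<le> ?q"
    using Hahn_Banach_sublinear[OF sublinear_tilt[OF sublinear_norm]] .
  have le: "f v \<le> norm v" for v
    using f(2)[THEN le_funD, of v] tilt_le[OF sublinear_norm, of x v] by simp
  have minus: "f (- v) = - f v" for v
    using f(1) by (rule linear_neg)
  have abs: "\<bar>f v\<bar> \<le> norm v" for v
    using le[of v] le[of "- v"] by (simp add: minus abs_le_iff)
  have "f (- x) \<le> - norm x"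
    using f(2)[THEN le_funD, of "- x"] tilt_le_at[OF sublinear_norm, of 1 x "- x"] by simp
  with le[of x] have "f x = norm x"
    by (simp add: minus)
  with f abs show ?thesis by (intro that)
qed

section \<open>Norming functionals over both scalar fields\<close>

definition norming :: "('k::real_normed_field \<Rightarrow> 'a::real_normed_vector \<Rightarrow> 'a) \<Rightarrow> bool"
  where "norming s \<longleftrightarrow> (\<forall>x. \<exists>f\<in>dual_ball s. norm (f x) = norm x)"

lemma norming_scaleR: "norming (scaleR :: real \<Rightarrow> 'a::real_normed_vector \<Rightarrow> 'a)"
  unfolding norming_def
proof
  fix x :: 'a
  obtain f :: "'a \<Rightarrow> real" where f: "linear f" "\<And>v. \<bar>f v\<bar> \<le> norm v" "f x = norm x"
    using norming_real_functional[of x] by blast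
  have bl: "bounded_linear f"
    using f(1,2) by (intro bounded_linear.intro bounded_linear_axioms.intro exI[of _ 1]) auto
  moreover have "onorm f \<le> 1"
    by (rule onorm_bound) (use f in auto)
  ultimately have "f \<in> dual_ball scaleR"
    by (simp add: dual_ball_def dual_scaleR)
  with f(3) show "\<exists>f\<in>dual_ball scaleR. norm (f x) = norm x"
    by (intro bexI[of _ f]) auto
qed

text \<open>
  \<open>F\<close> is the complex linear functional with real part \<open>f\<close>.  Passing to it does not increase the
  norm: rotate \<open>v\<close> by a unit scalar \<open>c\<close> so that \<open>F (c v)\<close> is real and nonnegative, hence equal to
  \<open>f (c v) \<le> norm v\<close>.
\<close>

lemma (in complex_banach_space) norming: "norming s"
  unfolding norming_def
proof
  fix x :: 'a
  obtain f :: "'a \<Rightarrow> real" where f: "linear f" "\<And>v. \<bar>f v\<bar> \<le> norm v" "f x = norm x"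
    using norming_real_functional[of x] by blast
  define F where "F v = Complex (f v) (- f (s \<i> v))" for v
  have f_of_real: "f (s (of_real r) v) = r * f v" for r v
    using linear_scale[OF f(1)] by (simp add: scale_of_real)
  have f_add: "f (u + v) = f u + f v" for u v
    using f(1) by (rule linear_add)
  have F_add: "F (u + v) = F u + F v" for u v
    by (simp add: F_def complex_eq_iff f_add scale_right_distrib)
  have F_real: "F (s (of_real r) v) = of_real r * F v" for r v
  proof -
    have "s \<i> (s (of_real r) v) = s (of_real r) (s \<i> v)"
      by (simp add: mult.commute)
    then show ?thesis
      by (simp add: F_def complex_eq_iff f_of_real del: scale_scale)
  qed
  have F_i: "F (s \<i> v) = \<i> * F v" for v
  proof -
    have "s \<i> (s \<i> v) = s (of_real (- 1)) v" by simp
    then have "f (s \<i> (s \<i> v)) = - f v"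
      using f_of_real[of "- 1" v] by simp
    then show ?thesis by (simp add: F_def complex_eq_iff)
  qed
  have F_scale: "F (s c v) = c * F v" for c v
  proof -
    have "s c v = s (of_real (Re c)) v + s (of_real (Im c)) (s \<i> v)"
      by (simp add: scale_left_distrib[symmetric] complex_eq_iff mult.commute)
    then have "F (s c v) = of_real (Re c) * F v + of_real (Im c) * (\<i> * F v)"
      by (simp only: F_add F_real F_i)
    also have "\<dots> = c * F v"
      by (simp add: complex_eq_iff)
    finally show ?thesis .
  qed
  have F_le: "norm (F v) \<le> norm v" for v
  proof (cases "F v = 0")
    case False
    define c where "c = cnj (F v) / norm (F v)"
    have c1: "norm c = 1" using False by (simp add: c_def norm_divide)
    have "F (s c v) = norm (F v)"
      using False by (simp add: F_scale c_def complex_norm_square[symmetric] power2_eq_square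
          mult.commute)
    then have "norm (F v) = f (s c v)"
      by (simp add: F_def complex_eq_iff)
    also have "\<dots> \<le> norm (s c v)"
      using f(2)[of "s c v"] by simp
    finally show ?thesis using c1 by (simp add: norm_scale)
  qed simp
  have bl: "bounded_linear F"
  proof (rule bounded_linear_intro[of _ 1])
    show "F (r *\<^sub>R v) = r *\<^sub>R F v" for r v
      using F_real[of r v] by (simp add: scale_of_real scaleR_conv_of_real)
  qed (use F_add F_le in auto)
  moreover have "onorm F \<le> 1"
    by (rule onorm_bound) (use F_le in auto)
  ultimately have "F \<in> dual_ball s"
    by (simp add: dual_ball_def dual_def F_scale)
  moreover have "norm (F x) = norm x"
    using F_le[of x] complex_Re_le_cmod[of "F x"] f(3) by (simp add: F_def)
  ultimately show "\<exists>F\<in>dual_ball s. norm (F x) = norm x" by blast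
qed

section \<open>The \<open>l\<^sub>p\<close> norm\<close>

text \<open>
  The unit ball of \<open>l\<^sub>1\<close> lies in that of \<open>l\<^sub>p\<close>: each term is at most \<open>1\<close>, so its \<open>p\<close>-th power is not
  larger than the term itself.
\<close>

lemma lp_norm_le_oneI:
  assumes p: "1 \<le> p" and bound: "\<And>N. (\<Sum>n<N. norm (a n)) \<le> 1"
  shows "lp_norm p a \<le> 1"
proof -
  have one: "norm (a n) \<le> 1" for n
  proof -
    have "norm (a n) \<le> (\<Sum>i<Suc n. norm (a i))"
      by (rule member_le_sum) auto
    with bound[of "Suc n"] show ?thesis by simp
  qed
  have le: "norm (a n) powr p \<le> norm (a n)" for n
  proof (cases "a n = 0")
    case False
    then have "norm (a n) powr p \<le> norm (a n) powr 1"
      using p one by (intro powr_mono') auto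
    then show ?thesis by simp
  qed simp
  have sums: "(\<Sum>n<N. norm (a n) powr p) \<le> 1" for N
    using sum_mono[of "{..<N}", OF le] bound[of N] by (rule order_trans)
  have sm: "summable (\<lambda>n. norm (a n) powr p)"
    by (rule summableI_nonneg_bounded[of _ 1]) (use sums in auto)
  have "(\<Sum>n. norm (a n) powr p) \<le> 1"
    by (rule suminf_le_const[OF sm sums])
  then have "(\<Sum>n. norm (a n) powr p) powr (1 / p) \<le> 1"
    using p using suminf_nonneg[OF sm] by (intro powr_le1) auto
  with sm show ?thesis by (simp add: lp_norm_def)
qed

lemma lp_norm_one_sum_le:
  assumes "lp_norm 1 a \<le> 1" and "finite I"
  shows "(\<Sum>n\<in>I. norm (a n)) \<le> 1"
proof -
  have sm: "summable (\<lambda>n. norm (a n))"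
    using assms by (auto simp: lp_norm_def split: if_splits)
  then have "(\<Sum>n. norm (a n)) \<le> 1"
    using assms by (auto simp: lp_norm_def suminf_nonneg)
  with sum_le_suminf[OF sm assms(2)] show ?thesis by simp
qed

lemma
  assumes "0 < p" and "lp_norm p a \<le> 1"
  shows lp_norm_term_le: "norm (a n) \<le> 1"
    and lp_norm_tendsto_zero: "a \<longlonglongrightarrow> 0"
proof -
  have sm: "summable (\<lambda>n. norm (a n) powr p)"
    and le: "(\<Sum>n. norm (a n) powr p) powr (1 / p) \<le> 1"
    using assms by (auto simp: lp_norm_def split: if_splits)
  have root: "(norm (a n) powr p) powr (1 / p) = norm (a n)" for n
    using assms(1) by (simp add: powr_powr)
  have "norm (a n) powr p \<le> (\<Sum>n. norm (a n) powr p)"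
    using sum_le_suminf[OF sm, of "{n}"] by simp
  then have "(norm (a n) powr p) powr (1 / p) \<le> (\<Sum>n. norm (a n) powr p) powr (1 / p)"
    using assms(1) by (intro powr_mono2) auto
  with le root show "norm (a n) \<le> 1" by simp
  have "(\<lambda>n. (norm (a n) powr p) powr (1 / p)) \<longlonglongrightarrow> 0"
    using assms(1) by (intro tendsto_zero_powrI[OF summable_LIMSEQ_zero[OF sm] tendsto_const]) auto
  then show "a \<longlonglongrightarrow> 0"
    unfolding root by (rule tendsto_norm_zero_cancel)
qed

lemma weak_lp_norm_le_one_iff:
  "weak_lp_norm s p x \<le> 1 \<longleftrightarrow> (\<forall>f\<in>dual_ball s. lp_norm p (\<lambda>n. f (x n)) \<le> 1)"
  by (simp add: weak_lp_norm_def SUP_le_iff)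

lemma weakly_p_summable_if_le_one: "weak_lp_norm s p x \<le> 1 \<Longrightarrow> weakly_p_summable s p x"
  by (auto simp: weakly_p_summable_def intro: le_less_trans)

text \<open>
  Weak Cauchyness tests all functionals and the weak \<open>p\<close>-norm only those in the unit ball; this
  rescaling passes from one to the other.
\<close>

lemma dual_ball_normalize:
  assumes "f \<in> dual s"
  obtains r where "r \<noteq> 0" "(\<lambda>x. r *\<^sub>R f x) \<in> dual_ball s"
proof
  have f: "bounded_linear f" using assms by (simp add: dual_def)
  \<comment> \<open>The summand \<open>1\<close> covers the case \<open>f = 0\<close>.\<close>
  let ?r = "inverse (onorm f + 1)"
  have pos: "0 \<le> onorm f" using f by (rule onorm_pos_le)
  then show "?r \<noteq> 0" by simp
  have "onorm (\<lambda>x. ?r *\<^sub>R f x) \<le> 1"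
    using pos by (simp add: onorm_scaleR[OF f] field_simps)
  moreover have "bounded_linear (\<lambda>x. ?r *\<^sub>R f x)"
    using f by (rule bounded_linear_compose[OF bounded_linear_scaleR_right])
  ultimately show "(\<lambda>x. ?r *\<^sub>R f x) \<in> dual_ball s"
    using assms by (simp add: dual_ball_def dual_def)
qed

section \<open>Unconditionally Cauchy series and weakly summable sequences\<close>

text \<open>
  Since the half-open blocks \<open>{l j<..k j}\<close> are disjoint, the \<open>l\<^sub>1\<close> norm of \<open>f\<close> along the block sums is
  at most the one along \<open>x\<close>.
\<close>

lemma weak_lp_norm_blocks_le_one:
  fixes l k :: "nat \<Rightarrow> nat"
  assumes p: "1 \<le> p" and x: "weak_lp_norm s 1 x \<le> 1"
    and block: "\<And>j. l j \<le> k j" and next_block: "\<And>j. k j \<le> l (Suc j)"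
  shows "weak_lp_norm s p (\<lambda>j. \<Sum>i\<in>{l j<..k j}. x i) \<le> 1"
  unfolding weak_lp_norm_le_one_iff
proof
  fix f assume f: "f \<in> dual_ball s"
  then have lin: "linear f"
    by (auto simp: dual_ball_def dual_def bounded_linear.linear)
  have fx: "lp_norm 1 (\<lambda>n. f (x n)) \<le> 1"
    using x f by (simp add: weak_lp_norm_le_one_iff)
  have "(\<Sum>j<N. norm (f (\<Sum>i\<in>{l j<..k j}. x i))) \<le> (\<Sum>i\<le>l N. norm (f (x i)))" for N
  proof (induction N)
    case (Suc N)
    have "norm (f (\<Sum>i\<in>{l N<..k N}. x i)) \<le> (\<Sum>i\<in>{l N<..k N}. norm (f (x i)))"
      by (simp add: linear_sum[OF lin] norm_sum)
    with Suc have "(\<Sum>j<Suc N. norm (f (\<Sum>i\<in>{l j<..k j}. x i)))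
        \<le> (\<Sum>i\<le>l N. norm (f (x i))) + (\<Sum>i\<in>{l N<..k N}. norm (f (x i)))"
      by simp
    also have "\<dots> = (\<Sum>i\<in>{..l N} \<union> {l N<..k N}. norm (f (x i)))"
      by (rule sum.union_disjoint[symmetric]) auto
    also have "\<dots> \<le> (\<Sum>i\<le>l (Suc N). norm (f (x i)))"
      using block[of N] next_block[of N] by (intro sum_mono2) auto
    finally show ?case .
  qed (simp add: sum_nonneg)
  also have "(\<Sum>i\<le>l N. norm (f (x i))) \<le> 1" for N
    using fx by (rule lp_norm_one_sum_le) simp
  finally show "lp_norm p (\<lambda>j. f (\<Sum>i\<in>{l j<..k j}. x i)) \<le> 1"
    using p by (intro lp_norm_le_oneI)
qed

text \<open>
  Differences of partial sums of \<open>\<Sum>i. T (x i)\<close> are the images of block sums of \<open>x\<close>.  Any \<open>c\<close>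
  below the oscillation is exceeded by infinitely many disjoint blocks, chosen one after another.
\<close>

lemma uc_le_uc6:
  fixes T :: "'a::real_normed_vector \<Rightarrow> 'b::real_normed_vector"
  assumes T: "linear T" and p: "1 \<le> p"
  shows "uc s T \<le> uc6 s p T"
  unfolding uc_def
proof (rule Sup_least, clarify)
  fix x assume x: "weak_lp_norm s 1 x \<le> 1"
  let ?S = "\<lambda>n. \<Sum>i\<le>n. T (x i)"
  show "ca ?S \<le> uc6 s p T"
  proof (rule dense_le)
    fix c assume c: "c < ca ?S"
    \<comment> \<open>The two indices are ordered by symmetry of the norm; they may coincide if \<open>c < 0\<close>.\<close>
    have gap: "\<exists>l k. n \<le> l \<and> l \<le> k \<and> c < norm (?S k - ?S l)" for n
    proof -
      have "c < Sup {ereal (norm (?S k - ?S l)) | k l. n \<le> k \<and> n \<le> l}"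
        using c unfolding ca_def by (rule less_le_trans) (rule INF_lower, simp)
      then obtain k l where kl: "n \<le> k" "n \<le> l" "c < norm (?S k - ?S l)"
        by (auto simp: less_Sup_iff)
      show ?thesis
      proof (cases "l \<le> k")
        case True
        with kl show ?thesis by blast
      next
        case False
        with kl show ?thesis
          by (intro exI[of _ k] exI[of _ l]) (auto simp: norm_minus_commute)
      qed
    qed
    define P where "P b \<longleftrightarrow> fst b \<le> snd b \<and> c < norm (?S (snd b) - ?S (fst b))"
      for b :: "nat \<times> nat"
    have P: "\<exists>b. P b \<and> n \<le> fst b" for n
      using gap[of n] by (auto simp: P_def)
    have "\<exists>b. \<forall>j. P (b j) \<and> snd (b j) \<le> fst (b (Suc j))"
      by (rule dependent_nat_choice[of "\<lambda>_. P" "\<lambda>_ b b'. snd b \<le> fst b'"]) (use P in blast)+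
    then obtain b where Pb: "\<And>j. P (b j)" and b: "\<And>j. snd (b j) \<le> fst (b (Suc j))"
      by blast
    have block: "fst (b j) \<le> snd (b j)" and large: "c < norm (?S (snd (b j)) - ?S (fst (b j)))" for j
      using Pb[of j] by (auto simp: P_def)
    define y where "y j = (\<Sum>i\<in>{fst (b j)<..snd (b j)}. x i)" for j
    have Ty: "T (y j) = ?S (snd (b j)) - ?S (fst (b j))" for j
    proof -
      have "{..snd (b j)} = {..fst (b j)} \<union> {fst (b j)<..snd (b j)}"
        using block[of j] by auto
      then have "?S (snd (b j)) = ?S (fst (b j)) + (\<Sum>i\<in>{fst (b j)<..snd (b j)}. T (x i))"
        by (simp only:) (rule sum.union_disjoint, auto)
      then show ?thesis by (simp add: y_def linear_sum[OF T])
    qed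
    have y: "weak_lp_norm s p y \<le> 1"
      unfolding y_def using p x block b by (rule weak_lp_norm_blocks_le_one)
    have "c \<le> limsup (\<lambda>j. ereal (norm (T (y j))))"
      by (rule le_Limsup) (use large in \<open>auto simp: Ty less_imp_le\<close>)
    also have "\<dots> \<le> uc6 s p T"
      unfolding uc6_def using y weakly_p_summable_if_le_one[OF y] by (intro Sup_upper) blast
    finally show "c \<le> uc6 s p T" .
  qed
qed

section \<open>Weakly summable sequences and weakly Cauchy sequences\<close>

text \<open>
  The witness is \<open>x\<close> interleaved with zeros: the term \<open>x m\<close> at position \<open>2 * m\<close> is followed by \<open>0\<close>,
  so the oscillation of the image beyond \<open>n\<close> is at least \<open>norm (T (x m))\<close> for all \<open>m \<ge> n\<close>.
\<close>

lemma uc6_le_cc: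
  fixes T :: "'a::real_normed_vector \<Rightarrow> 'b::real_normed_vector"
  assumes norming: "norming s" and T: "linear T" and p: "0 < p"
  shows "uc6 s p T \<le> cc s T"
  unfolding uc6_def
proof (rule Sup_least, clarify)
  fix x assume x: "weak_lp_norm s p x \<le> 1"
  have fx: "lp_norm p (\<lambda>n. f (x n)) \<le> 1" if "f \<in> dual_ball s" for f
    using x that by (simp add: weak_lp_norm_le_one_iff)
  define z where "z n = (if even n then x (n div 2) else 0)" for n
  have "norm (x n) \<le> 1" for n
  proof -
    obtain f where f: "f \<in> dual_ball s" "norm (f (x n)) = norm (x n)"
      using norming by (auto simp: norming_def)
    with lp_norm_term_le[OF p fx[OF f(1)], of n] show ?thesis by simp
  qed
  then have ball: "range z \<subseteq> cball 0 1"
    by (auto simp: z_def)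
  have Cauchy: "weakly_Cauchy s z"
    unfolding weakly_Cauchy_def
  proof
    fix f assume f: "f \<in> dual s"
    then have lin: "linear f"
      by (simp add: dual_def bounded_linear.linear)
    obtain r where r: "r \<noteq> 0" "(\<lambda>x. r *\<^sub>R f x) \<in> dual_ball s"
      using f by (rule dual_ball_normalize)
    have "(\<lambda>n. inverse r *\<^sub>R (r *\<^sub>R f (x n))) \<longlonglongrightarrow> inverse r *\<^sub>R 0"
      using lp_norm_tendsto_zero[OF p fx[OF r(2)]] by (intro tendsto_scaleR tendsto_const)
    then have null: "(\<lambda>n. f (x n)) \<longlonglongrightarrow> 0"
      using r(1) by simp
    have "(\<lambda>n. f (x (n div 2))) \<longlonglongrightarrow> 0"
      by (rule filterlim_compose[OF null filterlim_at_top_div_const_nat]) simp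
    then have "(\<lambda>n. f (z n)) \<longlonglongrightarrow> 0"
      by (rule Lim_null_comparison[rotated, OF tendsto_norm_zero])
        (auto simp: z_def linear_0[OF lin])
    then show "Cauchy (\<lambda>n. f (z n))"
      by (intro convergent_Cauchy) (auto simp: convergent_def)
  qed
  have "limsup (\<lambda>n. ereal (norm (T (x n)))) \<le> ca (\<lambda>n. T (z n))"
    unfolding limsup_INF_SUP ca_def
  proof (rule INF_mono, rule bexI)
    fix n :: nat
    show "(SUP m\<in>{n..}. ereal (norm (T (x m))))
        \<le> Sup {ereal (norm (T (z k) - T (z l))) | k l. n \<le> k \<and> n \<le> l}"
    proof (rule SUP_least)
      fix m assume "m \<in> {n..}"
      then have "n \<le> 2 * m" "n \<le> 2 * m + 1" by auto
      moreover have "T (x m) = T (z (2 * m)) - T (z (2 * m + 1))"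
        by (simp add: z_def linear_0[OF T])
      ultimately show "ereal (norm (T (x m)))
          \<le> Sup {ereal (norm (T (z k) - T (z l))) | k l. n \<le> k \<and> n \<le> l}"
        by (intro Sup_upper CollectI exI[of _ "2 * m"] exI[of _ "2 * m + 1"]) simp
    qed
  qed simp
  also have "\<dots> \<le> cc s T"
    unfolding cc_def using ball Cauchy by (intro Sup_upper) blast
  finally show "limsup (\<lambda>n. ereal (norm (T (x n)))) \<le> cc s T" .
qed

section \<open>The comparison of the three quantities\<close>

theorem theorem4p5:
  fixes p :: real
  assumes "1 \<le> p"
  shows "(\<forall>T :: 'a::banach \<Rightarrow> 'b::banach. bounded_linear T \<longrightarrow>
            uc scaleR T \<le> uc6 scaleR p T \<and> uc6 scaleR p T \<le> cc scaleR T) \<and>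
         (\<forall>(sX :: complex \<Rightarrow> 'c::banach \<Rightarrow> 'c) (sY :: complex \<Rightarrow> 'd::banach \<Rightarrow> 'd) T.
            complex_banach_space sX \<longrightarrow> complex_banach_space sY \<longrightarrow>
            bounded_linear T \<longrightarrow> Vector_Spaces.linear sX sY T \<longrightarrow>
            uc sX T \<le> uc6 sX p T \<and> uc6 sX p T \<le> cc sX T)"
  using assms
  by (auto intro!: uc_le_uc6 uc6_le_cc norming_scaleR complex_banach_space.norming
      bounded_linear.linear)

end
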